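(* Let $\alpha\in(0,1)$ and let $c:\mathbb{R}\to\mathbb{R}^n$ be a smooth curve which is a soliton of the mapping $M_\alpha$, i.e. there are $\epsilon>0$ and a smooth map $s\in(-\epsilon,\epsilon)\mapsto(A(s),b(s))\in\mathrm{Aff}(n)$ such that $$(1-\alpha)c(t)+\alpha c(t+s)=A(s)c(t)+b(s)\qquad\text{for all } s\in(-\epsilon,\epsilon),\ t\in\mathbb{R}.$$ Assume in addition that for some $t_0\in\mathbb{R}$ the vectors $\dot c(t_0),\ddot c(t_0),\dots,c^{(n)}(t_0)$ are linearly independent. Let $B=\alpha^{-1}A'(0)$ and $d=\alpha^{-1}b'(0)$, where $'$ denotes differentiation with respect to $s$. Then $c$ is the unique solution of the differential equation $$\dot c(t)=Bc(t)+d$$ with initial condition $c(0)=v$, where $v$ is the initial point of the given curve. Moreover, for all $s\in(-\epsilon,\epsilon)$, $$A(s)=(1-\alpha)\mathbb{1}+\alpha\exp(Bs),\qquad b(s)=\alpha F_B(s)d .$$ Hence $c$ is the orbit of $v$ under the one-parameter subgroup $$t\in\mathbb{R}\mapsto B(t):=\exp\left(t\begin{pmatrix}B&d\\0&0\end{pmatrix}\right)=\begin{pmatrix}\exp(Bt)&F_B(t)d\\0&1\end{pmatrix}$$ of the affine group $\mathrm{Aff}(n)$ acting on $\mathbb{R}^n$, i.e. $c(t)=B(t)\cdot v=\exp(Bt)v+F_B(t)d=v+F_B(t)(Bv+d)$ for all $t\in\mathbb{R}$.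
   Context: $\mathrm{Aff}(n)$ is the group of affine maps $(A,b):x\mapsto Ax+b$ of $\mathbb{R}^n$ with $A\in\mathrm{GL}(n,\mathbb{R})$ and $b\in\mathbb{R}^n$. It is identified with the group of matrices $\begin{pmatrix}A&b\\0&1\end{pmatrix}\in\mathrm{GL}(n+1,\mathbb{R})$, and $x\in\mathbb{R}^n$ is identified with $\begin{pmatrix}x\\1\end{pmatrix}$, so that the matrix action corresponds to $x\mapsto Ax+b$. $\mathbb{1}$ is the identity matrix. For a real $n\times n$ matrix $B$ and $t\in\mathbb{R}$, $F_B(t)=\sum_{k=1}^\infty\frac{t^k}{k!}B^{k-1}$. Dots denote differentiation with respect to the curve parameter $t$. *)

theory Defs
  imports "HOL-Analysis.Analysis"
begin

definition nth_deriv :: "nat \<Rightarrow> (real \<Rightarrow> 'a::real_normed_vector) \<Rightarrow> real \<Rightarrow> 'a" where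
  "nth_deriv k f = ((\<lambda>g t. vector_derivative g (at t)) ^^ k) f"

text \<open>Only used for open \<open>S\<close>, where derivatives at points of \<open>S\<close> depend only on the
  restriction of the function to \<open>S\<close>.\<close>

definition smooth_on :: "real set \<Rightarrow> (real \<Rightarrow> 'a::real_normed_vector) \<Rightarrow> bool" where
  "smooth_on S f \<longleftrightarrow> (\<forall>k. \<forall>t\<in>S. nth_deriv k f differentiable (at t))"

text \<open>The type class operations \<open>*\<close> and \<open>^\<close> on \<open>real^'n^'n\<close> act entrywise, so powers
  and the exponential with respect to the matrix product \<open>**\<close> are defined separately.\<close>

definition mat_pow :: "real^'n^'n \<Rightarrow> nat \<Rightarrow> real^'n^'n" where
  "mat_pow A k = (((**) A) ^^ k) (mat 1)"

definition mat_exp :: "real^'n^'n \<Rightarrow> real^'n^'n" where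
  "mat_exp A = (\<Sum>k. (1 / fact k) *\<^sub>R mat_pow A k)"

text \<open>The series \<open>F\<^sub>B(t) = \<Sum>\<^sub>k\<^sub>\<ge>\<^sub>1 t\<^sup>k/k! B\<^sup>k\<^sup>-\<^sup>1\<close>, with the summation index shifted by one.\<close>

definition F_series :: "real^'n^'n \<Rightarrow> real \<Rightarrow> real^'n^'n" where
  "F_series B t = (\<Sum>k. (t ^ Suc k / fact (Suc k)) *\<^sub>R mat_pow B k)"

text \<open>Matrices of size \<open>n + 1\<close> are indexed by \<open>'n option\<close>, where \<open>None\<close> is the last index:
  \<open>aff_block A b r\<close> is the matrix with block rows \<open>(A, b)\<close> and \<open>(0, r)\<close>, and
  \<open>hom_coords x\<close> is the column \<open>(x, 1)\<close>.\<close>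

definition aff_block :: "real^'n^'n \<Rightarrow> real^'n \<Rightarrow> real \<Rightarrow> real^(('n::finite) option)^('n option)" where
  "aff_block A b r = (\<chi> i j.
     case i of
       Some i' \<Rightarrow> (case j of Some j' \<Rightarrow> A $ i' $ j' | None \<Rightarrow> b $ i')
     | None \<Rightarrow> (case j of Some j' \<Rightarrow> 0 | None \<Rightarrow> r))"

definition hom_coords :: "real^'n \<Rightarrow> real^(('n::finite) option)" where
  "hom_coords x = (\<chi> i. case i of Some i' \<Rightarrow> x $ i' | None \<Rightarrow> 1)"

definition Aff :: "(real^(('n::finite) option)^('n option)) set" where
  "Aff = {aff_block A b 1 | (A :: real^'n^'n) b. invertible A}"

definition soliton_with ::
  "real \<Rightarrow> (real \<Rightarrow> real^'n) \<Rightarrow> real \<Rightarrow> (real \<Rightarrow> real^'n^'n) \<Rightarrow> (real \<Rightarrow> real^'n) \<Rightarrow> bool" where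
  "soliton_with \<alpha> c \<epsilon> A b \<longleftrightarrow>
     \<epsilon> > 0 \<and>
     (\<forall>s\<in>{-\<epsilon><..<\<epsilon>}. aff_block (A s) (b s) 1 \<in> Aff) \<and>
     smooth_on {-\<epsilon><..<\<epsilon>} (\<lambda>s. aff_block (A s) (b s) 1) \<and>
     (\<forall>s\<in>{-\<epsilon><..<\<epsilon>}. \<forall>t. (1 - \<alpha>) *\<^sub>R c t + \<alpha> *\<^sub>R c (t + s) = A s *v c t + b s)"

definition one_parameter_subgroup_of_Aff :: "(real \<Rightarrow> real^(('n::finite) option)^('n option)) \<Rightarrow> bool" where
  "one_parameter_subgroup_of_Aff P \<longleftrightarrow>
     (\<forall>t. P t \<in> Aff) \<and> smooth_on UNIV P \<and> (\<forall>s t. P (s + t) = P s ** P t)"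

definition unique_affine_ode_solution ::
  "real^'n^'n \<Rightarrow> real^'n \<Rightarrow> real^'n \<Rightarrow> (real \<Rightarrow> real^'n) \<Rightarrow> bool" where
  "unique_affine_ode_solution B d v c \<longleftrightarrow>
     (let is_sol = (\<lambda>y. (\<forall>t. (y has_vector_derivative B *v y t + d) (at t)) \<and> y 0 = v)
      in is_sol c \<and> (\<forall>y. is_sol y \<longrightarrow> y = c))"

end

theory Submission
  imports Defs
begin

text \<open>Differentiating the soliton equation in \<open>s\<close> at \<open>s = 0\<close> gives the affine differential equation for
  \<open>c\<close>. Its solutions satisfy \<open>c(t + s) = exp(Bs) c(t) + F\<^sub>B(s) d\<close>; substituting this back shows
  that a matrix \<open>M(s)\<close> sends \<open>c(t)\<close> to a vector independent of \<open>t\<close>, so it kills all derivatives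
  of \<open>c\<close>. These span the space at \<open>t\<^sub>0\<close>, hence \<open>M(s) = 0\<close>, which is the formula for \<open>A(s)\<close>.\<close>

section \<open>Exponential power series with vector coefficients\<close>

text \<open>The exponential generating function of \<open>a\<close>. Both the exponential and
  \<open>F_series\<close> have this form, and differentiation in \<open>t\<close> becomes a shift of
  the coefficients.\<close>

definition egf :: "(nat \<Rightarrow> 'a::euclidean_space) \<Rightarrow> real \<Rightarrow> 'a" where
  "egf a t = (\<Sum>k. (t ^ k / fact k) *\<^sub>R a k)"

text \<open>A growth bound that makes \<open>egf\<close> converge for every \<open>t\<close>, holds
  for matrix powers, and survives an index shift.\<close>

definition geo_bounded :: "(nat \<Rightarrow> 'a::euclidean_space) \<Rightarrow> bool" where
  "geo_bounded a \<longleftrightarrow> (\<exists>C R. \<forall>k. norm (a k) \<le> C * R ^ k)"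

text \<open>The terms are dominated by \<open>C\<close> times those of the real exponential series
  at \<bar>t\<bar> * R.\<close>

lemma egf_summable:
  assumes "geo_bounded a"
  shows "summable (\<lambda>k. (t ^ k / fact k) *\<^sub>R a k)"
proof -
  obtain C R where CR: "\<And>k. norm (a k) \<le> C * R ^ k"
    using assms unfolding geo_bounded_def by blast
  have le: "norm ((t ^ k / fact k) *\<^sub>R a k) \<le> C * (inverse (fact k) * (\<bar>t\<bar> * R) ^ k)" for k
  proof -
    have "norm ((t ^ k / fact k) *\<^sub>R a k) = (\<bar>t\<bar> ^ k / fact k) * norm (a k)"
      by (simp add: power_abs)
    also have "\<dots> \<le> (\<bar>t\<bar> ^ k / fact k) * (C * R ^ k)"
      by (intro mult_left_mono CR) simp
    finally show ?thesis
      by (simp add: field_simps)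
  qed
  have "summable (\<lambda>k. C * (inverse (fact k) * (\<bar>t\<bar> * R) ^ k))"
    by (intro summable_mult summable_exp)
  then show ?thesis
    using le by (rule summable_comparison_test'[where N = 0])
qed

lemma egf_linear:
  assumes "bounded_linear L" "geo_bounded a"
  shows "L (egf a t) = egf (\<lambda>k. L (a k)) t"
  using bounded_linear.suminf[OF assms(1) egf_summable[OF assms(2), of t]]
  by (simp add: egf_def linear_simps[OF assms(1)])

lemma egf_0 [simp]: "egf a 0 = a 0"
proof -
  have "(\<lambda>k. (0 ^ k / fact k) *\<^sub>R a k) sums (\<Sum>k\<in>{0}. (0 ^ k / fact k) *\<^sub>R a k)"
    by (rule sums_finite) (auto simp: power_0_left)
  then show ?thesis
    unfolding egf_def by (simp add: sums_iff)
qed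

text \<open>Against each basis vector this is termwise differentiation of a real power series: the
  factor k + 1 turns 1/(k+1)! into 1/k!, which leaves the shifted coefficients.\<close>

lemma egf_has_vector_derivative:
  assumes "geo_bounded a"
  shows "(egf a has_vector_derivative egf (\<lambda>k. a (Suc k)) t) (at t)"
proof -
  have Suc_bounded: "geo_bounded (\<lambda>k. a (Suc k))"
  proof -
    obtain C R where CR: "\<And>k. norm (a k) \<le> C * R ^ k"
      using assms unfolding geo_bounded_def by blast
    have "norm (a (Suc k)) \<le> (C * R) * R ^ k" for k
      using CR[of "Suc k"] by (simp add: mult_ac)
    then show ?thesis
      unfolding geo_bounded_def by blast
  qed
  have "((\<lambda>t. egf a t \<bullet> i) has_derivative (\<lambda>h. (h *\<^sub>R egf (\<lambda>k. a (Suc k)) t) \<bullet> i)) (at t)" for i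
  proof -
    define c where "c k = (a k \<bullet> i) / fact k" for k
    have inner_i: "egf e x \<bullet> i = (\<Sum>k. (e k \<bullet> i) / fact k * x ^ k)" if "geo_bounded e" for e x
      using egf_linear[OF bounded_linear_inner_left that] by (simp add: egf_def mult_ac)
    have "summable (\<lambda>k. c k * y ^ k)" for y
      using bounded_linear.summable[OF bounded_linear_inner_left egf_summable[OF assms]]
      by (simp add: c_def mult_ac)
    then have "((\<lambda>x. \<Sum>k. c k * x ^ k) has_field_derivative (\<Sum>k. diffs c k * t ^ k)) (at t)"
      by (rule termdiffs_strong_converges_everywhere)
    moreover have "diffs c k = (a (Suc k) \<bullet> i) / fact k" for k
      by (simp add: diffs_def c_def field_simps del: of_nat_Suc)
    ultimately show ?thesis
      by (simp add: inner_i assms Suc_bounded c_def has_field_derivative_def mult_commute_abs)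
  qed
  then show ?thesis
    unfolding has_vector_derivative_def by (subst has_derivative_componentwise_within) blast
qed

section \<open>Matrix exponential\<close>

lemma bounded_bilinear_matrix_mult:
  "bounded_bilinear ((**) :: real^'n::finite^'m::finite \<Rightarrow> real^'p::finite^'n \<Rightarrow> real^'p^'m)"
  unfolding bilinear_conv_bounded_bilinear[symmetric] bilinear_def
  by (auto intro!: linearI simp: matrix_add_ldistrib scalar_matrix_assoc matrix_scalar_ac)
    (simp add: vec_eq_iff matrix_matrix_mult_def algebra_simps sum.distrib)

lemma bounded_bilinear_matrix_vector_mult:
  "bounded_bilinear ((*v) :: real^'n::finite^'m::finite \<Rightarrow> real^'n \<Rightarrow> real^'m)"
  unfolding bilinear_conv_bounded_bilinear[symmetric] bilinear_def
  by (auto intro!: linearI simp: matrix_vector_right_distrib matrix_vector_mult_add_rdistrib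
      scaleR_matrix_vector_assoc matrix_vector_mult_scaleR)

lemmas bounded_linear_matrix_mult_left =
  bounded_bilinear.bounded_linear_left[OF bounded_bilinear_matrix_mult]
lemmas bounded_linear_matrix_mult_right =
  bounded_bilinear.bounded_linear_right[OF bounded_bilinear_matrix_mult]
lemmas bounded_linear_matrix_vector_mult_left =
  bounded_bilinear.bounded_linear_left[OF bounded_bilinear_matrix_vector_mult]

lemma (in bounded_bilinear) has_vector_derivative:
  assumes "(f has_vector_derivative f') (at t)" "(g has_vector_derivative g') (at t)"
  shows "((\<lambda>t. prod (f t) (g t)) has_vector_derivative prod (f t) g' + prod f' (g t)) (at t)"
  using FDERIV[OF assms[unfolded has_vector_derivative_def]]
  by (simp add: has_vector_derivative_def scaleR_left scaleR_right scaleR_right_distrib)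

lemmas has_vector_derivative_matrix_mult =
  bounded_bilinear.has_vector_derivative[OF bounded_bilinear_matrix_mult]
lemmas has_vector_derivative_matrix_vector_mult =
  bounded_bilinear.has_vector_derivative[OF bounded_bilinear_matrix_vector_mult]

lemma mat_pow_0 [simp]: "mat_pow A 0 = mat 1"
  by (simp add: mat_pow_def)

lemma mat_pow_Suc: "mat_pow A (Suc k) = A ** mat_pow A k"
  by (simp add: mat_pow_def)

lemma mat_pow_commute: "mat_pow A k ** A = A ** mat_pow A k"
  by (induction k) (simp_all add: mat_pow_Suc matrix_mul_assoc[symmetric])

lemma mat_pow_scaleR: "mat_pow (t *\<^sub>R A) k = t ^ k *\<^sub>R mat_pow A k"
  by (induction k) (simp_all add: mat_pow_Suc scalar_matrix_assoc matrix_scalar_ac mult.commute)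

text \<open>Boundedness of the bilinear product makes the norm submultiplicative up to a factor
  \<open>K\<close>, which the ratio \<open>norm A * K\<close> absorbs.\<close>

lemma geo_bounded_mat_pow: "geo_bounded (mat_pow (A :: real^'n::finite^'n))"
proof -
  obtain K where K: "K > 0" "\<And>(X :: real^'n^'n) (Y :: real^'n^'n). norm (X ** Y) \<le> norm X * norm Y * K"
    using bounded_bilinear.pos_bounded[OF bounded_bilinear_matrix_mult] by blast
  have "norm (mat_pow A k) \<le> norm (mat 1 :: real^'n^'n) * (norm A * K) ^ k" for k
  proof (induction k)
    case (Suc k)
    have "norm (mat_pow A (Suc k)) \<le> norm A * norm (mat_pow A k) * K"
      unfolding mat_pow_Suc by (rule K)
    also have "\<dots> \<le> norm A * (norm (mat 1 :: real^'n^'n) * (norm A * K) ^ k) * K"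
      using K(1) Suc by (intro mult_right_mono mult_left_mono) auto
    finally show ?case
      by (simp add: mult_ac)
  qed simp
  then show ?thesis
    unfolding geo_bounded_def by blast
qed

lemma mat_exp_eq_egf: "mat_exp (t *\<^sub>R A) = egf (mat_pow A) t"
  by (simp add: mat_exp_def egf_def mat_pow_scaleR)

lemma mat_exp_0 [simp]: "mat_exp (0 :: real^'n::finite^'n) = mat 1"
  using mat_exp_eq_egf[of 0 "0 :: real^'n^'n"] by simp

lemma mat_exp_commute: "mat_exp (t *\<^sub>R A) ** A = A ** mat_exp (t *\<^sub>R A)"
  unfolding mat_exp_eq_egf
  by (simp add: egf_linear[OF bounded_linear_matrix_mult_left geo_bounded_mat_pow]
      egf_linear[OF bounded_linear_matrix_mult_right geo_bounded_mat_pow] mat_pow_commute)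

text \<open>Shifting the coefficients A^k multiplies each by \<open>A\<close> on the left, and this
  factor pulls out of the series by linearity.\<close>

lemma has_vector_derivative_mat_exp:
  "((\<lambda>t. mat_exp (t *\<^sub>R A)) has_vector_derivative A ** mat_exp (t *\<^sub>R A)) (at t)"
  using egf_has_vector_derivative[OF geo_bounded_mat_pow, of A t]
  by (simp add: mat_exp_eq_egf mat_pow_Suc
      egf_linear[OF bounded_linear_matrix_mult_right geo_bounded_mat_pow])

lemma has_vector_derivative_shift:
  assumes "(f has_vector_derivative f') (at (s + t))"
  shows "((\<lambda>x. f (s + x)) has_vector_derivative f') (at (t :: real))"
proof -
  have "((\<lambda>x. s + x) has_vector_derivative 1) (at t)"
    by (auto intro!: derivative_eq_intros)
  from vector_diff_chain_at[OF this assms] show ?thesis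
    by (simp add: o_def)
qed

lemma has_vector_derivative_reflect:
  assumes "(f has_vector_derivative f') (at (- t))"
  shows "((\<lambda>x. f (- x)) has_vector_derivative - f') (at (t :: real))"
proof -
  have "(uminus has_vector_derivative - 1) (at t)"
    by (auto intro!: derivative_eq_intros)
  from vector_diff_chain_at[OF this assms] show ?thesis
    by (simp add: o_def)
qed

text \<open>The factor \<open>A\<close> is placed on the right, where it meets the \<open>A\<close>
  from X' = A X in the product rule.\<close>

lemma has_vector_derivative_mat_exp_neg:
  "((\<lambda>t. mat_exp (- t *\<^sub>R A)) has_vector_derivative - (mat_exp (- t *\<^sub>R A) ** A)) (at t)"
  unfolding mat_exp_commute
  by (rule has_vector_derivative_reflect[OF has_vector_derivative_mat_exp])

section \<open>Linear differential equations with constant coefficients\<close>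

lemma constant_if_derivative_0:
  fixes f :: "real \<Rightarrow> 'a::real_normed_vector"
  assumes "\<And>t. (f has_vector_derivative 0) (at t)"
  shows "f t = f 0"
  using has_vector_derivative_zero_constant[of UNIV f] assms by (metis UNIV_I convex_UNIV)

text \<open>The two terms of the product rule cancel. No inverse of the exponential is used, so the
  choice X(t) = exp(tA) can supply that inverse.\<close>

lemma linear_ode_matrix_conserved:
  assumes "\<And>t. (X has_vector_derivative A ** X t) (at t)"
  shows "mat_exp (- t *\<^sub>R A) ** X t = X 0"
proof -
  have "((\<lambda>t. mat_exp (- t *\<^sub>R A) ** X t) has_vector_derivative 0) (at t)" for t
    using has_vector_derivative_matrix_mult[OF has_vector_derivative_mat_exp_neg[of A t] assms]
    by (simp add: matrix_mul_assoc bounded_bilinear.minus_left[OF bounded_bilinear_matrix_mult])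
  from constant_if_derivative_0[OF this, of t] show ?thesis
    by simp
qed

lemma mat_exp_inverse_left: "mat_exp (- t *\<^sub>R A) ** mat_exp (t *\<^sub>R A) = mat 1"
  using linear_ode_matrix_conserved[OF has_vector_derivative_mat_exp] by simp

lemma mat_exp_inverse_right: "mat_exp (t *\<^sub>R A) ** mat_exp (- t *\<^sub>R A) = mat 1"
  using mat_exp_inverse_left[of "- t" A] by simp

lemma linear_ode_matrix_solution:
  assumes "\<And>t. (X has_vector_derivative A ** X t) (at t)"
  shows "X t = mat_exp (t *\<^sub>R A) ** X 0"
  using arg_cong[where f = "(**) (mat_exp (t *\<^sub>R A))", OF linear_ode_matrix_conserved[OF assms, of t]]
  by (simp add: matrix_mul_assoc mat_exp_inverse_right del: scaleR_minus_left)

lemma linear_ode_vector_solution: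
  assumes "\<And>t. (x has_vector_derivative A *v x t) (at t)"
  shows "x t = mat_exp (t *\<^sub>R A) *v x 0"
proof -
  have "((\<lambda>t. mat_exp (- t *\<^sub>R A) *v x t) has_vector_derivative 0) (at t)" for t
    using has_vector_derivative_matrix_vector_mult[OF has_vector_derivative_mat_exp_neg[of A t] assms]
    by (simp add: matrix_vector_mul_assoc
        bounded_bilinear.minus_left[OF bounded_bilinear_matrix_vector_mult])
  from constant_if_derivative_0[OF this, of t] have "mat_exp (- t *\<^sub>R A) *v x t = x 0"
    by simp
  from arg_cong[where f = "(*v) (mat_exp (t *\<^sub>R A))", OF this] show ?thesis
    by (simp add: matrix_vector_mul_assoc mat_exp_inverse_right del: scaleR_minus_left)
qed

text \<open>For fixed \<open>t\<close>, exp((t+s)A) solves X' = A X in \<open>s\<close> with initial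
  value exp(tA), and solutions are determined by their initial value.\<close>

lemma mat_exp_add: "mat_exp ((s + t) *\<^sub>R A) = mat_exp (s *\<^sub>R A) ** mat_exp (t *\<^sub>R A)"
proof -
  have "((\<lambda>s. mat_exp ((t + s) *\<^sub>R A)) has_vector_derivative A ** mat_exp ((t + s) *\<^sub>R A)) (at s)" for s
    by (rule has_vector_derivative_shift[OF has_vector_derivative_mat_exp])
  from linear_ode_matrix_solution[OF this, of s] show ?thesis
    by (simp add: add.commute)
qed

section \<open>Iterated derivatives and smoothness of the exponential\<close>

lemma nth_deriv_0 [simp]: "nth_deriv 0 f = f"
  by (simp add: nth_deriv_def)

lemma nth_deriv_Suc: "nth_deriv (Suc k) f t = vector_derivative (nth_deriv k f) (at t)"
  by (simp add: nth_deriv_def)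

lemma smooth_on_has_vector_derivative:
  assumes "smooth_on S f" "t \<in> S"
  shows "(nth_deriv k f has_vector_derivative nth_deriv (Suc k) f t) (at t)"
  using assms by (simp add: smooth_on_def nth_deriv_Suc vector_derivative_works)

text \<open>The k-th derivative has the closed form A^k exp(tA), which is again
  differentiable.\<close>

lemma smooth_mat_exp: "smooth_on UNIV (\<lambda>t. mat_exp (t *\<^sub>R A))"
proof -
  have deriv: "((\<lambda>t. mat_pow A k ** mat_exp (t *\<^sub>R A)) has_vector_derivative
      mat_pow A (Suc k) ** mat_exp (t *\<^sub>R A)) (at t)" for k t
    using has_vector_derivative_matrix_mult[OF has_vector_derivative_const
        has_vector_derivative_mat_exp[of A t], of "mat_pow A k"]
    by (simp add: mat_pow_Suc matrix_mul_assoc mat_pow_commute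
        bounded_bilinear.zero_left[OF bounded_bilinear_matrix_mult])
  have "nth_deriv k (\<lambda>t. mat_exp (t *\<^sub>R A)) = (\<lambda>t. mat_pow A k ** mat_exp (t *\<^sub>R A))" for k
  proof (induction k)
    case (Suc k)
    show ?case
      by (rule ext) (simp add: nth_deriv_Suc Suc vector_derivative_at[OF deriv])
  qed simp
  then show ?thesis
    using deriv by (auto simp: smooth_on_def intro: differentiableI_vector)
qed

section \<open>The series \<open>F_series\<close> and affine block matrices\<close>

text \<open>\<open>F_series B\<close> is the \<open>egf\<close> of 0, 1, B, B^2, ...; the shift that
  differentiates it leaves the coefficients of the exponential.\<close>

lemma
  fixes B :: "real^'n::finite^'n"
  shows F_series_0 [simp]: "F_series B 0 = 0"
    and has_vector_derivative_F_series:
      "(F_series B has_vector_derivative mat_exp (t *\<^sub>R B)) (at t)"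
proof -
  define a where "a k = (case k of 0 \<Rightarrow> 0 | Suc j \<Rightarrow> mat_pow B j)" for k
  obtain C R where CR: "\<And>k. norm (mat_pow B k) \<le> C * R ^ k"
    using geo_bounded_mat_pow unfolding geo_bounded_def by blast
  have "0 \<le> C"
    using CR[of 0] order_trans[OF norm_ge_zero] by simp
  \<comment> \<open>\<open>R\<close> may be negative or below 1. The base \<bar>R\<bar> + 1 is at
    least 1, so the exponent can be raised to \<open>Suc k\<close>, the index at which
    \<open>a\<close> takes the value \<open>mat_pow B k\<close>.\<close>
  have "norm (mat_pow B k) \<le> C * (\<bar>R\<bar> + 1) ^ Suc k" for k
  proof -
    have "C * R ^ k \<le> C * \<bar>R\<bar> ^ k"
      using \<open>0 \<le> C\<close> by (metis abs_ge_self mult_left_mono power_abs)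
    also have "\<dots> \<le> C * (\<bar>R\<bar> + 1) ^ k"
      using \<open>0 \<le> C\<close> by (intro mult_left_mono power_mono) auto
    also have "\<dots> \<le> C * (\<bar>R\<bar> + 1) ^ Suc k"
      using \<open>0 \<le> C\<close> by (intro mult_left_mono power_increasing) auto
    finally show ?thesis
      using CR[of k] by simp
  qed
  then have "norm (a k) \<le> C * (\<bar>R\<bar> + 1) ^ k" for k
    using \<open>0 \<le> C\<close> by (cases k) (simp_all add: a_def)
  then have bounded: "geo_bounded a"
    unfolding geo_bounded_def by blast
  have F: "F_series B = egf a"
  proof
    fix t
    show "F_series B t = egf a t"
      \<comment> \<open>The term at index 0 vanishes; dropping it gives the shifted sum that defines
        \<open>F_series\<close>.\<close>
      using suminf_split_head[OF egf_summable[OF bounded], of t]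
      by (simp add: F_series_def egf_def a_def del: fact_Suc power_Suc)
  qed
  show "F_series B 0 = 0"
    by (simp add: F a_def)
  show "(F_series B has_vector_derivative mat_exp (t *\<^sub>R B)) (at t)"
    using egf_has_vector_derivative[OF bounded, of t] by (simp add: F a_def mat_exp_eq_egf)
qed

text \<open>Both sides have derivative exp(tB) B = B exp(tB) and agree at t = 0.\<close>

lemma mat_exp_eq_F_series: "mat_exp (t *\<^sub>R B) = mat 1 + F_series B t ** B"
proof -
  have "((\<lambda>t. mat_exp (t *\<^sub>R B) - F_series B t ** B) has_vector_derivative 0) (at t)" for t
    using has_vector_derivative_diff[OF has_vector_derivative_mat_exp[of B t]
        bounded_linear.has_vector_derivative[OF bounded_linear_matrix_mult_left
          has_vector_derivative_F_series[of B t]], of B]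
    by (simp add: mat_exp_commute)
  from constant_if_derivative_0[OF this, of t] show ?thesis
    by (simp add: algebra_simps bounded_bilinear.zero_left[OF bounded_bilinear_matrix_mult])
qed

section \<open>Affine maps in homogeneous coordinates\<close>

lemma sum_UNIV_option:
  fixes f :: "'a::finite option \<Rightarrow> 'b::comm_monoid_add"
  shows "(\<Sum>i\<in>UNIV. f i) = f None + (\<Sum>i\<in>UNIV. f (Some i))"
  by (simp add: UNIV_option_conv sum.reindex)

text \<open>The free corner entries let one rule cover products of group elements (corner 1) and of
  a generator (corner 0) with a group element.\<close>

lemma aff_block_mult:
  "aff_block X x r ** aff_block Y y q = aff_block (X ** Y) (X *v y + q *\<^sub>R x) (r * q)"
  by (simp add: vec_eq_iff aff_block_def matrix_matrix_mult_def matrix_vector_mult_def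
      sum_UNIV_option algebra_simps split: option.split)

lemma aff_block_vector_mult:
  "aff_block X x 1 *v hom_coords y = hom_coords (X *v y + x)"
  by (simp add: vec_eq_iff aff_block_def hom_coords_def matrix_vector_mult_def
      sum_UNIV_option algebra_simps split: option.split)

lemma aff_block_one: "aff_block (mat 1) 0 1 = mat 1"
  by (simp add: vec_eq_iff aff_block_def mat_def split: option.split)

lemma hom_coords_inject [simp]: "hom_coords x = hom_coords y \<longleftrightarrow> x = y"
proof
  assume eq: "hom_coords x = hom_coords y"
  have "x $ i = hom_coords x $ Some i" "y $ i = hom_coords y $ Some i" for i
    by (simp_all add: hom_coords_def)
  with eq show "x = y"
    by (simp add: vec_eq_iff)
qed simp

text \<open>The block depends linearly on its two entries once the constant corner \<open>r\<close>
  is split off; hence the corner 0 in the derivative.\<close>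

lemma has_vector_derivative_aff_block:
  fixes X :: "real \<Rightarrow> real^'n::finite^'n"
  assumes "(X has_vector_derivative X') (at t)" "(x has_vector_derivative x') (at t)"
  shows "((\<lambda>t. aff_block (X t) (x t) r) has_vector_derivative aff_block X' x' 0) (at t)"
proof -
  have "linear (\<lambda>z. aff_block (fst z) (snd z) 0 :: real^('n option)^('n option))"
    by (intro linearI) (simp_all add: vec_eq_iff aff_block_def split: option.split)
  from bounded_linear.has_vector_derivative[OF this[unfolded linear_conv_bounded_linear]
      has_vector_derivative_Pair[OF assms]]
  have "((\<lambda>t. aff_block (X t) (x t) 0) has_vector_derivative aff_block X' x' 0) (at t)"
    by simp
  then have "((\<lambda>t. aff_block (X t) (x t) 0 + aff_block 0 0 r)
      has_vector_derivative aff_block X' x' 0) (at t)"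
    by (auto intro!: derivative_eq_intros)
  moreover have "aff_block (X t) (x t) 0 + aff_block 0 0 r = aff_block (X t) (x t) r" for t
    by (simp add: vec_eq_iff aff_block_def split: option.split)
  ultimately show ?thesis
    by simp
qed

text \<open>\<open>soliton_with\<close> asks for smoothness of the block as a whole; its parts are
  linear images of it and inherit differentiability.\<close>

lemma differentiable_aff_block_components:
  fixes X :: "real \<Rightarrow> real^'n::finite^'n"
  assumes "(\<lambda>t. aff_block (X t) (x t) r) differentiable (at t)"
  shows "X differentiable (at t)" "x differentiable (at t)"
proof -
  have "linear (\<lambda>Z :: real^('n option)^('n option). (\<chi> i j. Z $ Some i $ Some j) :: real^'n^'n)"
    "linear (\<lambda>Z :: real^('n option)^('n option). (\<chi> i. Z $ Some i $ None) :: real^'n)"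
    by (auto intro!: linearI simp: vec_eq_iff)
  then have "(\<lambda>t. (\<chi> i j. aff_block (X t) (x t) r $ Some i $ Some j) :: real^'n^'n) differentiable (at t)"
    "(\<lambda>t. (\<chi> i. aff_block (X t) (x t) r $ Some i $ None) :: real^'n) differentiable (at t)"
    using assms unfolding differentiable_def linear_conv_bounded_linear
    by (blast dest: bounded_linear.has_derivative)+
  then show "X differentiable (at t)" "x differentiable (at t)"
    by (simp_all add: aff_block_def)
qed

text \<open>The claimed right-hand side \<open>G\<close> satisfies the differential equation of the
  exponential and equals the identity at 0, so uniqueness identifies the two.\<close>

lemma mat_exp_aff_block:
  fixes B :: "real^'n::finite^'n"
  shows "mat_exp (t *\<^sub>R aff_block B d 0) = aff_block (mat_exp (t *\<^sub>R B)) (F_series B t *v d) 1"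
proof -
  define G where "G t = aff_block (mat_exp (t *\<^sub>R B)) (F_series B t *v d) 1" for t
  \<comment> \<open>Both products vanish at 0 and have the same derivative, since exp(tB) commutes
    with \<open>B\<close>.\<close>
  have comm: "F_series B t ** B = B ** F_series B t" for t
  proof -
    have "((\<lambda>t. F_series B t ** B - B ** F_series B t) has_vector_derivative 0) (at t)" for t
      using has_vector_derivative_diff[OF
          bounded_linear.has_vector_derivative[OF bounded_linear_matrix_mult_left
            has_vector_derivative_F_series[of B t]]
          bounded_linear.has_vector_derivative[OF bounded_linear_matrix_mult_right
            has_vector_derivative_F_series[of B t]], of B B]
      by (simp add: mat_exp_commute)
    from constant_if_derivative_0[OF this, of t] show ?thesis
      by (simp add: bounded_bilinear.zero_left[OF bounded_bilinear_matrix_mult]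
          bounded_bilinear.zero_right[OF bounded_bilinear_matrix_mult])
  qed
  have "(G has_vector_derivative aff_block B d 0 ** G t) (at t)" for t
  proof -
    \<comment> \<open>This matches the upper right blocks: the derivative of \<open>G\<close> has
      exp(tB) d there, the product of generator and \<open>G\<close> has B F_B(t) d + d.\<close>
    have "mat_exp (t *\<^sub>R B) *v d = B *v (F_series B t *v d) + d"
      by (simp add: mat_exp_eq_F_series comm matrix_vector_mul_assoc matrix_vector_mult_add_rdistrib)
    then show ?thesis
      using has_vector_derivative_aff_block[OF has_vector_derivative_mat_exp[of B t]
          bounded_linear.has_vector_derivative[OF bounded_linear_matrix_vector_mult_left
            has_vector_derivative_F_series[of B t]], of d 1]
      by (simp add: G_def[abs_def] aff_block_mult)
  qed
  from linear_ode_matrix_solution[OF this, of t] show ?thesis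
    by (simp add: G_def aff_block_one)
qed

lemma mat_exp_aff_block_in_Aff: "mat_exp (t *\<^sub>R aff_block B d 0) \<in> Aff"
proof -
  have "invertible (mat_exp (t *\<^sub>R B))"
    unfolding invertible_def using mat_exp_inverse_left mat_exp_inverse_right by blast
  then show ?thesis
    unfolding mat_exp_aff_block Aff_def by blast
qed

text \<open>In homogeneous coordinates an affine differential equation becomes a linear one.\<close>

lemma affine_ode_solution:
  fixes B :: "real^'n::finite^'n"
  assumes "\<And>t. (x has_vector_derivative B *v x t + d) (at t)"
  shows "hom_coords (x t) = mat_exp (t *\<^sub>R aff_block B d 0) *v hom_coords (x 0)"
proof -
  have "((\<lambda>t. hom_coords (x t)) has_vector_derivative aff_block B d 0 *v hom_coords (x t)) (at t)" for t
  proof -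
    \<comment> \<open>\<open>hom_coords\<close> is affine because of its last entry 1; subtracting
      its value at 0 makes it linear.\<close>
    have "linear (\<lambda>y. hom_coords y - hom_coords 0 :: real^('n option))"
      by (intro linearI) (simp_all add: vec_eq_iff hom_coords_def split: option.split)
    then have "((\<lambda>t. hom_coords (x t) - hom_coords 0) has_vector_derivative
        hom_coords (B *v x t + d) - hom_coords 0) (at t)"
      by (intro bounded_linear.has_vector_derivative[OF _ assms])
        (simp add: linear_conv_bounded_linear)
    then have "((\<lambda>t. (hom_coords (x t) - hom_coords 0) + hom_coords 0) has_vector_derivative
        hom_coords (B *v x t + d) - hom_coords 0) (at t)"
      by (simp only: has_vector_derivative_add_const)
    moreover have "hom_coords (B *v x t + d) - hom_coords 0 = aff_block B d 0 *v hom_coords (x t)"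
      by (simp add: vec_eq_iff aff_block_def hom_coords_def matrix_vector_mult_def
          sum_UNIV_option algebra_simps split: option.split)
    ultimately show ?thesis
      by simp
  qed
  then show ?thesis
    by (rule linear_ode_vector_solution)
qed

lemma affine_ode_solution_explicit:
  assumes "\<And>t. (x has_vector_derivative B *v x t + d) (at t)"
  shows "x t = mat_exp (t *\<^sub>R B) *v x 0 + F_series B t *v d"
  using affine_ode_solution[OF assms, of t] by (simp add: mat_exp_aff_block aff_block_vector_mult)

section \<open>Solitons\<close>

text \<open>Differentiating the constant M c(t) shows that \<open>M\<close> kills every derivative
  of order at least 1, and at \<open>t0\<close> the first n of these form a basis.\<close>

lemma matrix_eq_0_if_constant_on_curve:
  fixes c :: "real \<Rightarrow> real^'n::finite" and M :: "real^'n^'m::finite"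
  assumes "smooth_on UNIV c" "\<And>t. M *v c t = w"
    and "inj_on (\<lambda>k. nth_deriv k c t0) {1..CARD('n)}"
    and "independent ((\<lambda>k. nth_deriv k c t0) ` {1..CARD('n)})"
  shows "M = 0"
proof -
  let ?S = "(\<lambda>k. nth_deriv k c t0) ` {1..CARD('n)}"
  \<comment> \<open>The constant \<open>u\<close> is arbitrary: it is \<open>w\<close> at order 0
    and 0 at every later order.\<close>
  have const: "M *v nth_deriv (Suc k) c t = 0" if "\<And>t. M *v nth_deriv k c t = u" for k t u
  proof -
    have "((\<lambda>t. M *v nth_deriv k c t) has_vector_derivative M *v nth_deriv (Suc k) c t) (at t)"
      using smooth_on_has_vector_derivative[OF assms(1)]
      by (intro bounded_linear.has_vector_derivative[OF matrix_vector_mul_bounded_linear]) auto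
    then show ?thesis
      using that has_vector_derivative_const vector_derivative_unique_at by fastforce
  qed
  have "M *v nth_deriv (Suc k) c t = 0" for k t
    by (induction k arbitrary: t) (use assms(2) in \<open>auto intro: const\<close>)
  then have kills: "M *v x = 0" if "x \<in> ?S" for x
    using that by (auto simp: Suc_le_eq gr0_conv_Suc)
  \<comment> \<open>Independence concerns the set of derivatives; injectivity of the indexing
    ensures that it has n elements.\<close>
  have "card ?S = DIM(real^'n)"
    using card_image[OF assms(3)] by simp
  then have "span ?S = UNIV"
    using assms(4) by (metis dim_eq_card_independent dim_eq_full)
  then have "M *v x = 0" for x
    using linear_eq_0_on_span[of "(*v) M" ?S x] kills by simp
  then show ?thesis
    by (simp add: matrix_eq)
qed

lemma soliton_ode:
  assumes "\<alpha> \<noteq> 0" "smooth_on UNIV c" "soliton_with \<alpha> c \<epsilon> A b"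
  shows "(c has_vector_derivative
    ((1 / \<alpha>) *\<^sub>R vector_derivative A (at 0)) *v c t + (1 / \<alpha>) *\<^sub>R vector_derivative b (at 0)) (at t)"
proof -
  let ?c' = "nth_deriv 1 c t"
  have eps: "0 < \<epsilon>"
    and eq: "\<And>s. s \<in> {-\<epsilon><..<\<epsilon>} \<Longrightarrow> (1 - \<alpha>) *\<^sub>R c t + \<alpha> *\<^sub>R c (t + s) = A s *v c t + b s"
    and "smooth_on {-\<epsilon><..<\<epsilon>} (\<lambda>s. aff_block (A s) (b s) 1)"
    using assms(3) by (auto simp: soliton_with_def)
  then have "(\<lambda>s. aff_block (A s) (b s) 1) differentiable (at 0)"
    unfolding smooth_on_def by (metis greaterThanLessThan_iff neg_less_0_iff_less nth_deriv_0)
  then have A: "(A has_vector_derivative vector_derivative A (at 0)) (at 0)"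
    and b: "(b has_vector_derivative vector_derivative b (at 0)) (at 0)"
    using differentiable_aff_block_components vector_derivative_works by blast+
  have c: "(c has_vector_derivative ?c') (at t)"
    using smooth_on_has_vector_derivative[OF assms(2), of t 0] by simp
  have "((\<lambda>s. A s *v c t + b s) has_vector_derivative
      vector_derivative A (at 0) *v c t + vector_derivative b (at 0)) (at 0)"
    by (intro has_vector_derivative_add b
        bounded_linear.has_vector_derivative[OF bounded_linear_matrix_vector_mult_left A])
  moreover have "((\<lambda>s. A s *v c t + b s) has_vector_derivative \<alpha> *\<^sub>R ?c') (at 0)"
  \<comment> \<open>The soliton equation holds only for \<bar>s\<bar> < \<epsilon>, but this is an
    open neighbourhood of 0, which suffices for a derivative there.\<close>
  proof (rule has_vector_derivative_transform_within_open[where S = "{-\<epsilon><..<\<epsilon>}"])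
    have "((\<lambda>s. c (t + s)) has_vector_derivative ?c') (at 0)"
      using has_vector_derivative_shift[of c _ t 0] c by simp
    from has_vector_derivative_add[OF has_vector_derivative_const
        bounded_linear.has_vector_derivative[OF bounded_linear_scaleR_right this]]
    show "((\<lambda>s. (1 - \<alpha>) *\<^sub>R c t + \<alpha> *\<^sub>R c (t + s)) has_vector_derivative \<alpha> *\<^sub>R ?c') (at 0)"
      by simp
  qed (use eps eq in auto)
  ultimately have "\<alpha> *\<^sub>R ?c' = vector_derivative A (at 0) *v c t + vector_derivative b (at 0)"
    using vector_derivative_unique_at by blast
  then have "?c' = (1 / \<alpha>) *\<^sub>R (vector_derivative A (at 0) *v c t + vector_derivative b (at 0))"
    using assms(1) by (metis divide_self_if scaleR_one scaleR_scaleR times_divide_eq_left mult_1)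
  with c show ?thesis
    by (simp add: scaleR_right_distrib scaleR_matrix_vector_assoc)
qed

lemma soliton_affine_maps:
  fixes c :: "real \<Rightarrow> real^'n::finite"
  assumes smooth: "smooth_on UNIV c" and soliton: "soliton_with \<alpha> c \<epsilon> A b"
    and indep: "inj_on (\<lambda>k. nth_deriv k c t0) {1..CARD('n)}"
      "independent ((\<lambda>k. nth_deriv k c t0) ` {1..CARD('n)})"
    and ode: "\<And>t. (c has_vector_derivative B *v c t + d) (at t)"
    and s: "s \<in> {-\<epsilon><..<\<epsilon>}"
  shows "A s = (1 - \<alpha>) *\<^sub>R mat 1 + \<alpha> *\<^sub>R mat_exp (s *\<^sub>R B)"
    and "b s = \<alpha> *\<^sub>R (F_series B s *v d)"
proof -
  let ?M = "A s - ((1 - \<alpha>) *\<^sub>R mat 1 + \<alpha> *\<^sub>R mat_exp (s *\<^sub>R B))"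
  let ?w = "\<alpha> *\<^sub>R (F_series B s *v d) - b s"
  have M: "?M *v c t = ?w" for t
  proof -
    \<comment> \<open>The equation is autonomous, so x \<mapsto> c(t + x) solves it too, with
      initial value c(t).\<close>
    have "c (t + s) = mat_exp (s *\<^sub>R B) *v c t + F_series B s *v d"
      using affine_ode_solution_explicit[OF has_vector_derivative_shift[OF ode], of t s] by simp
    then have "(1 - \<alpha>) *\<^sub>R c t + \<alpha> *\<^sub>R (mat_exp (s *\<^sub>R B) *v c t + F_series B s *v d) = A s *v c t + b s"
      using soliton s unfolding soliton_with_def by metis
    then show ?thesis
      by (simp add: scaleR_matrix_vector_assoc[symmetric] algebra_simps)
  qed
  have "?M = 0"
    by (rule matrix_eq_0_if_constant_on_curve[OF smooth M indep])
  then show "A s = (1 - \<alpha>) *\<^sub>R mat 1 + \<alpha> *\<^sub>R mat_exp (s *\<^sub>R B)"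
    by simp
  \<comment> \<open>Once \<open>?M\<close> vanishes, a single time gives \<open>?w\<close> =
    0.\<close>
  show "b s = \<alpha> *\<^sub>R (F_series B s *v d)"
    using M[of 0] unfolding \<open>?M = 0\<close> by simp
qed

theorem theorem2:
  fixes \<alpha> \<epsilon> t0 :: real
    and c :: "real \<Rightarrow> real^'n"
    and A :: "real \<Rightarrow> real^'n^'n"
    and b :: "real \<Rightarrow> real^'n"
    and B :: "real^'n^'n"
    and d v :: "real^'n"
    and P :: "real \<Rightarrow> real^(('n::finite) option)^('n option)"
  assumes alpha: "0 < \<alpha>" "\<alpha> < 1"
    and smooth: "smooth_on UNIV c"
    and soliton: "soliton_with \<alpha> c \<epsilon> A b"
    and indep: "inj_on (\<lambda>k. nth_deriv k c t0) {1..CARD('n)}"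
      "independent ((\<lambda>k. nth_deriv k c t0) ` {1..CARD('n)})"
    and B: "B = (1 / \<alpha>) *\<^sub>R vector_derivative A (at 0)"
    and d: "d = (1 / \<alpha>) *\<^sub>R vector_derivative b (at 0)"
    and v: "v = c 0"
    and P: "P = (\<lambda>t. mat_exp (t *\<^sub>R aff_block B d 0))"
  shows "unique_affine_ode_solution B d v c
    \<and> (\<forall>s\<in>{-\<epsilon><..<\<epsilon>}.
         A s = (1 - \<alpha>) *\<^sub>R mat 1 + \<alpha> *\<^sub>R mat_exp (s *\<^sub>R B)
         \<and> b s = \<alpha> *\<^sub>R (F_series B s *v d))
    \<and> one_parameter_subgroup_of_Aff P
    \<and> (\<forall>t. P t = aff_block (mat_exp (t *\<^sub>R B)) (F_series B t *v d) 1)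
    \<and> (\<forall>t. hom_coords (c t) = P t *v hom_coords v
         \<and> c t = mat_exp (t *\<^sub>R B) *v v + F_series B t *v d
         \<and> c t = v + F_series B t *v (B *v v + d))"
proof -
  have ode: "(c has_vector_derivative B *v c t + d) (at t)" for t
    unfolding B d using alpha by (intro soliton_ode[OF _ smooth soliton]) simp
  \<comment> \<open>The explicit formula expresses any solution through its value at 0, which
    \<open>y\<close> and \<open>c\<close> share.\<close>
  have "y = c" if "\<And>t. (y has_vector_derivative B *v y t + d) (at t)" "y 0 = v" for y
    using affine_ode_solution_explicit[OF ode] affine_ode_solution_explicit[OF that(1)] that(2) v
    by (intro ext) metis
  then have "unique_affine_ode_solution B d v c"
    using ode v by (simp add: unique_affine_ode_solution_def Let_def)
  moreover have "A s = (1 - \<alpha>) *\<^sub>R mat 1 + \<alpha> *\<^sub>R mat_exp (s *\<^sub>R B)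
      \<and> b s = \<alpha> *\<^sub>R (F_series B s *v d)" if "s \<in> {-\<epsilon><..<\<epsilon>}" for s
    using soliton_affine_maps[OF smooth soliton indep ode that] by blast
  moreover have "one_parameter_subgroup_of_Aff P"
    unfolding one_parameter_subgroup_of_Aff_def P
    using mat_exp_aff_block_in_Aff smooth_mat_exp mat_exp_add by blast
  moreover have "P t = aff_block (mat_exp (t *\<^sub>R B)) (F_series B t *v d) 1" for t
    by (simp add: P mat_exp_aff_block)
  moreover have "hom_coords (c t) = P t *v hom_coords v" for t
    unfolding P v by (rule affine_ode_solution[OF ode])
  moreover have explicit: "c t = mat_exp (t *\<^sub>R B) *v v + F_series B t *v d" for t
    unfolding v by (rule affine_ode_solution_explicit[OF ode])
  \<comment> \<open>Substituting exp(tB) = 1 + F_B(t) B into the orbit formula collects both terms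
    under F_B(t).\<close>
  moreover have "c t = v + F_series B t *v (B *v v + d)" for t
    unfolding explicit mat_exp_eq_F_series
    by (simp add: matrix_vector_mult_add_rdistrib matrix_vector_right_distrib
        matrix_vector_mul_assoc add.assoc)
  ultimately show ?thesis
    by blast
qed

end
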